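(* Let $G=(G,\tau)$ be a topological group, $bG$ a $G$-compactification of $G$ with extended action $\tilde\alpha:G\times bG\to bG$, and let $G\subset X\subset bG$ be an invariant subset, with the restricted action $\tilde\alpha_X=\tilde\alpha|_{G\times X}$. Let $\tau_{co}$ and $\tau_p$ be the compact-open topology and the topology of pointwise convergence on $G$ for the action $\tilde\alpha_X$ of $G$ on $X$. Then $((G,\tau_{co}),X,\tilde\alpha_X)$ and $((G,\tau_p),X,\tilde\alpha_X)$ are $G$-spaces and $\tau=\tau_{co}=\tau_p$.
   Context: All spaces are Tychonoff. A $G$-space is a triple $(G,X,\theta)$ with $G$ a topological group and $\theta:G\times X\to X$ a continuous left action. A $G$-compactification of $G$ is a compact (Hausdorff) space $bG$ containing $G$ as a dense subspace (via a topological embedding) with a continuous action $\tilde\alpha:G\times bG\to bG$ such that $\tilde\alpha(g,h)=gh$ for $g,h\in G$. A subset $X\subset bG$ is invariant if $\tilde\alpha(G\times X)=X$. For an action of $G$ on $X$, the compact-open topology $\tau_{co}$ on $G$ has as a subbase the sets $[K,O]=\{g\in G: gK\subset O\}$, $K\subset X$ compact, $O\subset X$ open; the topology of pointwise convergence $\tau_p$ has as a subbase the sets $[x,O]=\{g\in G: gx\in O\}$, $x\in X$, $O\subset X$ open. The statement that $((G,\tau_{co}),X,\theta)$ (respectively $((G,\tau_p),X,\theta)$) is a $G$-space means that $\tau_{co}$ (respectively $\tau_p$) is a group topology on $G$ and the action is continuous for it. *)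

theory Defs
  imports "HOL-Analysis.Analysis" "HOL-Algebra.Group_Action"
begin

definition tychonoff_space :: "'a topology \<Rightarrow> bool"
  where "tychonoff_space T \<longleftrightarrow> completely_regular_space T \<and> Hausdorff_space T"

definition topological_group :: "('a, 'm) monoid_scheme \<Rightarrow> 'a topology \<Rightarrow> bool"
  where "topological_group G T \<longleftrightarrow>
    group G \<and> topspace T = carrier G \<and>
    continuous_map (prod_topology T T) T (\<lambda>(g, h). g \<otimes>\<^bsub>G\<^esub> h) \<and>
    continuous_map T T (\<lambda>g. inv\<^bsub>G\<^esub> g)"

text \<open>The library's \<^const>\<open>group_action\<close> requires each map \<open>\<theta> g\<close> to be extensional, i.e. to be
  undefined outside the space acted on; this only normalises junk values. The Tychonoff
  conditions reflect the standing convention that all spaces are Tychonoff.\<close>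

definition g_space ::
    "('a, 'm) monoid_scheme \<Rightarrow> 'a topology \<Rightarrow> 'b topology \<Rightarrow> ('a \<Rightarrow> 'b \<Rightarrow> 'b) \<Rightarrow> bool"
  where "g_space G T X \<theta> \<longleftrightarrow>
    topological_group G T \<and> tychonoff_space T \<and> tychonoff_space X \<and>
    group_action G (topspace X) \<theta> \<and>
    continuous_map (prod_topology T X) X (\<lambda>(g, x). \<theta> g x)"

text \<open>The inclusion of \<open>G\<close> in its compactification \<open>B\<close> is given by a topological embedding \<open>e\<close>,
  so that \<open>e ` carrier G\<close> is the copy of \<open>G\<close> in \<open>B\<close>.\<close>

definition g_compactification ::
    "('a, 'm) monoid_scheme \<Rightarrow> 'a topology \<Rightarrow> 'b topology \<Rightarrow> ('a \<Rightarrow> 'b) \<Rightarrow> ('a \<Rightarrow> 'b \<Rightarrow> 'b) \<Rightarrow> bool"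
  where "g_compactification G T B e \<alpha> \<longleftrightarrow>
    compact_space B \<and> Hausdorff_space B \<and>
    embedding_map T B e \<and> B closure_of (e ` carrier G) = topspace B \<and>
    g_space G T B \<alpha> \<and>
    (\<forall>g\<in>carrier G. \<forall>h\<in>carrier G. \<alpha> g (e h) = e (g \<otimes>\<^bsub>G\<^esub> h))"

definition invariant_subset ::
    "('a, 'm) monoid_scheme \<Rightarrow> ('a \<Rightarrow> 'b \<Rightarrow> 'b) \<Rightarrow> 'b set \<Rightarrow> bool"
  where "invariant_subset G \<alpha> X \<longleftrightarrow> (\<lambda>(g, x). \<alpha> g x) ` (carrier G \<times> X) = X"

text \<open>In \<open>subbase_topology U S\<close> the empty intersection is read as \<open>U\<close>, so the underlying set
  is \<open>U\<close> even if \<open>S\<close> does not cover it.\<close>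

definition subbase_topology :: "'a set \<Rightarrow> 'a set set \<Rightarrow> 'a topology"
  where "subbase_topology U S =
    topology (arbitrary union_of (finite intersection_of (\<lambda>V. V \<in> S) relative_to U))"

definition compact_open_topology ::
    "('a, 'm) monoid_scheme \<Rightarrow> 'b topology \<Rightarrow> ('a \<Rightarrow> 'b \<Rightarrow> 'b) \<Rightarrow> 'a topology"
  where "compact_open_topology G X \<theta> =
    subbase_topology (carrier G)
      {{g \<in> carrier G. \<theta> g ` K \<subseteq> V} | K V. compactin X K \<and> openin X V}"

definition pointwise_topology ::
    "('a, 'm) monoid_scheme \<Rightarrow> 'b topology \<Rightarrow> ('a \<Rightarrow> 'b \<Rightarrow> 'b) \<Rightarrow> 'a topology"
  where "pointwise_topology G X \<theta> =
    subbase_topology (carrier G)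
      {{g \<in> carrier G. \<theta> g x \<in> V} | x V. x \<in> topspace X \<and> openin X V}"

definition restrict_action :: "('a \<Rightarrow> 'b \<Rightarrow> 'b) \<Rightarrow> 'b set \<Rightarrow> 'a \<Rightarrow> 'b \<Rightarrow> 'b"
  where "restrict_action \<alpha> X = (\<lambda>g. restrict (\<alpha> g) X)"

end

theory Submission
  imports Defs
begin

text \<open>Continuity of the action makes every set \<open>[K, V]\<close> open in \<open>\<tau>\<close>, and points are compact, so
  \<open>\<tau>\<^sub>p \<subseteq> \<tau>\<^sub>c\<^sub>o \<subseteq> \<tau>\<close>. Conversely, the orbit map of the neutral element
  \<open>e \<one> \<in> X\<close> is the embedding \<open>e\<close> itself, so every \<open>\<tau>\<close>-open set is
  of the form \<open>[e \<one>, V]\<close> and \<open>\<tau> \<subseteq> \<tau>\<^sub>p\<close>.\<close>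

lemma topspace_subbase_topology [simp]: "topspace (subbase_topology U \<B>) = U"
  by (simp add: subbase_topology_def)

lemma openin_subbase_topology_inc:
  assumes "S \<in> \<B>" and "S \<subseteq> U"
  shows "openin (subbase_topology U \<B>) S"
  unfolding subbase_topology_def openin_subbase
  by (intro arbitrary_union_of_inc relative_to_subset_inc finite_intersection_of_inc assms)

text \<open>Reduces a comparison of topologies to subbasic sets. The hypothesis
  \<open>openin T U\<close> covers the empty intersection, which is read as
  \<open>U\<close>.\<close>

lemma openin_subbase_topology_minimal:
  assumes "openin (subbase_topology U \<B>) S" and "openin T U" and "\<And>B. B \<in> \<B> \<Longrightarrow> openin T B"
  shows "openin T S"
  using minimal_topology_subbase[of "\<lambda>V. V \<in> \<B>" T U S] assms
  unfolding subbase_topology_def by blast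

lemma invariant_subset_image_subset:
  assumes "invariant_subset G \<alpha> X" and "g \<in> carrier G"
  shows "\<alpha> g ` X \<subseteq> X"
  using assms unfolding invariant_subset_def by force

text \<open>Each element maps \<open>X\<close> into itself; using this for the inverse element as
  well shows that it maps \<open>X\<close> onto itself, hence permutes it. Cutting the maps down to
  \<open>X\<close> makes them extensional, as membership in \<open>Bij X\<close> demands.\<close>

lemma (in group_action) restrict_action_group_action:
  assumes X: "X \<subseteq> E" and inv: "invariant_subset G \<phi> X"
  shows "group_action G X (restrict_action \<phi> X)"
proof -
  interpret group G
    using group_hom by (rule group_hom.axioms)
  have mem: "\<phi> g x \<in> X" if "g \<in> carrier G" "x \<in> X" for g x
    using invariant_subset_image_subset[OF inv] that by blast
  have bij: "restrict (\<phi> g) X \<in> Bij X" if g: "g \<in> carrier G" for g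
  proof -
    have "X \<subseteq> \<phi> g ` X"
    proof
      fix x assume x: "x \<in> X"
      have "\<phi> g (\<phi> (inv g) x) = x"
        using orbit_sym_aux[OF inv_closed[OF g], of x] x X g by auto
      then show "x \<in> \<phi> g ` X"
        using mem[OF inv_closed[OF g] x] by (metis image_eqI)
    qed
    then have "\<phi> g ` X = X"
      using mem[OF g] by blast
    moreover have "inj_on (\<phi> g) X"
      using inj_prop[OF g] X by (rule inj_on_subset)
    ultimately show ?thesis
      by (simp add: Bij_def bij_betw_def inj_on_restrict_eq)
  qed
  have "restrict_action \<phi> X \<in> hom G (BijGroup X)"
  proof (rule homI)
    fix g assume "g \<in> carrier G"
    then show "restrict_action \<phi> X g \<in> carrier (BijGroup X)"
      using bij by (simp add: BijGroup_def restrict_action_def)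
  next
    fix g h assume g: "g \<in> carrier G" and h: "h \<in> carrier G"
    \<comment> \<open>The inner map keeps points of \<open>X\<close> inside \<open>X\<close>, so the
      outer restriction never takes its default value there; outside \<open>X\<close> both sides are
      undefined.\<close>
    have "restrict (\<phi> (g \<otimes> h)) X = compose X (restrict (\<phi> g) X) (restrict (\<phi> h) X)"
      using composition_rule[OF _ g h] X mem[OF h] by (auto simp: compose_def fun_eq_iff)
    then show "restrict_action \<phi> X (g \<otimes> h)
        = restrict_action \<phi> X g \<otimes>\<^bsub>BijGroup X\<^esub> restrict_action \<phi> X h"
      using bij[OF g] bij[OF h] by (simp add: BijGroup_def restrict_action_def)
  qed
  then show ?thesis
    unfolding group_action_def
    by (intro group_hom.intro group_hom_axioms.intro group_BijGroup is_group)
qed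

lemma tychonoff_space_subtopology:
  "tychonoff_space T \<Longrightarrow> tychonoff_space (subtopology T S)"
  by (simp add: tychonoff_space_def completely_regular_space_subtopology Hausdorff_space_subtopology)

lemma g_space_restrict_action:
  assumes "g_space G T Y \<alpha>" and X: "X \<subseteq> topspace Y" and inv: "invariant_subset G \<alpha> X"
  shows "g_space G T (subtopology Y X) (restrict_action \<alpha> X)"
proof -
  have T: "topspace T = carrier G"
    using assms(1) by (simp add: g_space_def topological_group_def)
  have top: "topspace (subtopology Y X) = X"
    using X by auto
  have "continuous_map (prod_topology T (subtopology Y X)) Y (\<lambda>(g, x). \<alpha> g x)"
    using assms(1) by (auto simp: g_space_def prod_topology_subtopology continuous_map_from_subtopology)
  moreover have "(\<lambda>(g, x). \<alpha> g x) \<in> topspace (prod_topology T (subtopology Y X)) \<rightarrow> X"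
    using invariant_subset_image_subset[OF inv] T by fastforce
  ultimately have "continuous_map (prod_topology T (subtopology Y X)) (subtopology Y X)
      (\<lambda>(g, x). \<alpha> g x)"
    by (simp add: continuous_map_in_subtopology image_subset_iff_funcset)
  \<comment> \<open>The restricted action differs from \<alpha> only at points outside
    \<open>X\<close>, which continuity does not see.\<close>
  then have "continuous_map (prod_topology T (subtopology Y X)) (subtopology Y X)
      (\<lambda>(g, x). restrict_action \<alpha> X g x)"
    by (rule continuous_map_eq) (auto simp: restrict_action_def)
  then show ?thesis
    using assms(1) tychonoff_space_subtopology group_action.restrict_action_group_action[OF _ X inv]
    unfolding g_space_def top by blast
qed

text \<open>A form of the tube lemma: the pairs \<open>(g, x)\<close> with \<open>x\<close> in
  \<open>K\<close> that are sent outside \<open>V\<close> form a closed set, and projecting along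
  the compact factor \<open>K\<close> is a closed map. The image consists of exactly those
  \<open>g\<close> that fail to send \<open>K\<close> into \<open>V\<close>.\<close>

lemma openin_compact_into_open:
  assumes cont: "continuous_map (prod_topology T X) Y (\<lambda>(g, x). \<theta> g x)"
    and K: "compactin X K" and V: "openin Y V"
  shows "openin T {g \<in> topspace T. \<theta> g ` K \<subseteq> V}"
proof -
  let ?P = "prod_topology T (subtopology X K)"
  let ?C = "{p \<in> topspace ?P. (\<lambda>(g, x). \<theta> g x) p \<in> topspace Y - V}"
  have KX: "K \<subseteq> topspace X"
    using K by (rule compactin_subset_topspace)
  have contK: "continuous_map ?P Y (\<lambda>(g, x). \<theta> g x)"
    using cont by (simp add: prod_topology_subtopology continuous_map_from_subtopology)
  have "closedin ?P ?C"
    using closedin_continuous_map_preimage[OF contK] V by blast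
  then have closed: "closedin T (fst ` ?C)"
    using Abstract_Topological_Spaces.closed_map_fst[OF compact_space_subtopology[OF K], of T]
    unfolding closed_map_def by blast
  \<comment> \<open>Thus a value outside \<open>V\<close> does lie in \<open>topspace Y - V\<close>,
    the set whose preimage is \<open>?C\<close>.\<close>
  have "\<theta> g x \<in> topspace Y" if "g \<in> topspace T" "x \<in> K" for g x
    using Pi_mem[OF continuous_map_funspace[OF cont], of "(g, x)"] that KX by auto
  then have "{g \<in> topspace T. \<theta> g ` K \<subseteq> V} = topspace T - fst ` ?C"
    using KX by (force simp: image_iff)
  then show ?thesis
    using closed by auto
qed

lemma compact_open_topology_coarser:
  assumes "g_space G T X \<theta>" and "openin (compact_open_topology G X \<theta>) S"
  shows "openin T S"
proof -
  have T: "topspace T = carrier G"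
    and cont: "continuous_map (prod_topology T X) X (\<lambda>(g, x). \<theta> g x)"
    using assms(1) by (auto simp: g_space_def topological_group_def)
  show ?thesis
    using assms(2) unfolding compact_open_topology_def
  proof (rule openin_subbase_topology_minimal)
    show "openin T (carrier G)"
      using T openin_topspace by metis
  next
    fix B assume "B \<in> {{g \<in> carrier G. \<theta> g ` K \<subseteq> V} |K V. compactin X K \<and> openin X V}"
    then obtain K V where B: "B = {g \<in> carrier G. \<theta> g ` K \<subseteq> V}" and "compactin X K" "openin X V"
      by blast
    then show "openin T B"
      using openin_compact_into_open[OF cont] T by simp
  qed
qed

lemma pointwise_topology_coarser:
  assumes "openin (pointwise_topology G X \<theta>) S"
  shows "openin (compact_open_topology G X \<theta>) S"
  using assms unfolding pointwise_topology_def
proof (rule openin_subbase_topology_minimal)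
  show "openin (compact_open_topology G X \<theta>) (carrier G)"
    using openin_topspace[of "compact_open_topology G X \<theta>"] by (simp add: compact_open_topology_def)
next
  fix B assume "B \<in> {{g \<in> carrier G. \<theta> g x \<in> V} |x V. x \<in> topspace X \<and> openin X V}"
  \<comment> \<open>The pointwise subbasic set is rewritten as a compact-open one with the compact
    set \<open>{x}\<close>.\<close>
  then obtain x V where B: "B = {g \<in> carrier G. \<theta> g ` {x} \<subseteq> V}" and "compactin X {x}" "openin X V"
    by auto
  then show "openin (compact_open_topology G X \<theta>) B"
    unfolding compact_open_topology_def
    by (intro openin_subbase_topology_inc) blast+
qed

text \<open>The orbit map carries \<open>S\<close> to a relatively open part of the orbit, cut out
  by some open \<open>V\<close>. Pulling back along the injective orbit map recovers
  \<open>S\<close> as the single subbasic set \<open>[x, V]\<close>.\<close>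

lemma pointwise_topology_finer:
  assumes orbit: "embedding_map T X (\<lambda>g. \<theta> g x)" and T: "topspace T = carrier G"
    and x: "x \<in> topspace X" and S: "openin T S"
  shows "openin (pointwise_topology G X \<theta>) S"
proof -
  let ?f = "\<lambda>g. \<theta> g x"
  have SG: "S \<subseteq> carrier G"
    using openin_subset[OF S] T by simp
  have hom: "homeomorphic_map T (subtopology X (?f ` carrier G)) ?f"
    using orbit T by (simp add: embedding_map_def)
  then have "openin (subtopology X (?f ` carrier G)) (?f ` S)"
    using S homeomorphic_imp_open_map open_map_def by blast
  then obtain V where V: "openin X V" and eq: "?f ` S = V \<inter> ?f ` carrier G"
    unfolding openin_subtopology by blast
  have inj: "inj_on ?f (carrier G)"
    using homeomorphic_imp_injective_map[OF hom] T by simp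
  have "S = {g \<in> carrier G. \<theta> g x \<in> V}"
  proof (intro equalityI subsetI)
    fix g assume "g \<in> {g \<in> carrier G. \<theta> g x \<in> V}"
    then have "g \<in> carrier G" "?f g \<in> ?f ` S"
      using eq by auto
    then show "g \<in> S"
      using inj_on_image_mem_iff[OF inj _ SG] by blast
  qed (use eq SG in auto)
  then show ?thesis
    unfolding pointwise_topology_def using x V SG
    by (intro openin_subbase_topology_inc) blast+
qed

theorem proposition2p10:
  fixes G :: "('a, 'm) monoid_scheme"
    and \<tau> :: "'a topology"
    and bG :: "'b topology"
    and e :: "'a \<Rightarrow> 'b"
    and \<alpha> :: "'a \<Rightarrow> 'b \<Rightarrow> 'b"
    and X :: "'b set"
  assumes "topological_group G \<tau>"
    and "tychonoff_space \<tau>"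
    and "g_compactification G \<tau> bG e \<alpha>"
    and "e ` carrier G \<subseteq> X"
    and "X \<subseteq> topspace bG"
    and "invariant_subset G \<alpha> X"
  defines "\<alpha>\<^sub>X \<equiv> restrict_action \<alpha> X"
    and "\<tau>\<^sub>c\<^sub>o \<equiv> compact_open_topology G (subtopology bG X) (restrict_action \<alpha> X)"
    and "\<tau>\<^sub>p \<equiv> pointwise_topology G (subtopology bG X) (restrict_action \<alpha> X)"
  shows "g_space G \<tau>\<^sub>c\<^sub>o (subtopology bG X) \<alpha>\<^sub>X
       \<and> g_space G \<tau>\<^sub>p (subtopology bG X) \<alpha>\<^sub>X
       \<and> \<tau> = \<tau>\<^sub>c\<^sub>o \<and> \<tau>\<^sub>c\<^sub>o = \<tau>\<^sub>p"
proof -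
  let ?X = "subtopology bG X"
  have T: "topspace \<tau> = carrier G"
    using assms(1) by (simp add: topological_group_def)
  interpret group G
    using assms(1) by (simp add: topological_group_def)
  have emb: "embedding_map \<tau> bG e" and bG: "g_space G \<tau> bG \<alpha>"
    and act: "\<And>g h. \<lbrakk>g \<in> carrier G; h \<in> carrier G\<rbrakk> \<Longrightarrow> \<alpha> g (e h) = e (g \<otimes>\<^bsub>G\<^esub> h)"
    using assms(3) by (auto simp: g_compactification_def)
  have g_space: "g_space G \<tau> ?X \<alpha>\<^sub>X"
    unfolding \<alpha>\<^sub>X_def using bG assms(5,6) by (rule g_space_restrict_action)
  have e1: "e \<one>\<^bsub>G\<^esub> \<in> X"
    using assms(4) by auto
  have "embedding_map \<tau> ?X e"
    using emb assms(4) T by (simp add: embedding_map_in_subtopology)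
  \<comment> \<open>The equivariance of \<open>e\<close> with \<open>h = \<one>\<close> identifies
    \<open>e\<close> with the orbit map of \<open>e \<one>\<close>; membership of
    \<open>e \<one>\<close> in \<open>X\<close> keeps the restricted action away from its default
    value.\<close>
  moreover have "e g = \<alpha>\<^sub>X g (e \<one>\<^bsub>G\<^esub>)" if "g \<in> topspace \<tau>" for g
    using that T e1 act[of g "\<one>\<^bsub>G\<^esub>"] by (simp add: \<alpha>\<^sub>X_def restrict_action_def)
  ultimately have orbit: "embedding_map \<tau> ?X (\<lambda>g. \<alpha>\<^sub>X g (e \<one>\<^bsub>G\<^esub>))"
    by (rule embedding_map_eq)
  have "openin \<tau>\<^sub>c\<^sub>o S \<Longrightarrow> openin \<tau> S" for S
    using compact_open_topology_coarser[OF g_space] unfolding \<tau>\<^sub>c\<^sub>o_def \<alpha>\<^sub>X_def .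
  moreover have "openin \<tau>\<^sub>p S \<Longrightarrow> openin \<tau>\<^sub>c\<^sub>o S" for S
    unfolding \<tau>\<^sub>p_def \<tau>\<^sub>c\<^sub>o_def by (rule pointwise_topology_coarser)
  moreover have "openin \<tau> S \<Longrightarrow> openin \<tau>\<^sub>p S" for S
    using pointwise_topology_finer[of \<tau> ?X \<alpha>\<^sub>X "e \<one>\<^bsub>G\<^esub>" G S] orbit T e1 assms(5)
    unfolding \<tau>\<^sub>p_def \<alpha>\<^sub>X_def by auto
  \<comment> \<open>The three inclusions close a cycle, so all three topologies coincide.\<close>
  ultimately have "\<tau> = \<tau>\<^sub>c\<^sub>o" "\<tau>\<^sub>c\<^sub>o = \<tau>\<^sub>p"
    unfolding topology_eq by blast+
  \<comment> \<open>Both topologies are \<tau> itself, so the group topology axioms and the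
    continuity of the action carry over from \<tau> without a separate check.\<close>
  then show ?thesis
    using g_space by simp
qed

end
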